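(* Let $F:2^{[n]}\to\mathbb{R}$ be submodular with $F(\emptyset)=0$, and suppose $g:\mathbb{R}^n\to\mathbb{R}$ is $\alpha$-smooth and $\beta$-strongly convex. Consider L-KM applied to $(g,F)$ and L-FCFW applied to $(h,F)$ with $h(w)=-g^*(-w)$, both started from the same set $\mathcal{V}^{(0)}$. In L-FCFW, suppose we choose $$\mathcal{B}^{(i)}=\mathcal{A}^{(i)}=\{v\in\mathcal{V}^{(i-1)}: v^\top x^{(i)}=(w^{(i)})^\top x^{(i)}\}.$$ Then: 1. the primal iterates $x^{(i)}$ of L-KM and L-FCFW match; 2. the sets $\mathcal{V}^{(i)}$ used at each iteration of L-KM and L-FCFW match; 3. the upper and lower bounds $p^{(i)}$ and $d^{(i)}$ of L-KM and L-FCFW match.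
   Context: $[n]=\{1,\dots,n\}$. $F$ is submodular if $F(A)+F(B)\ge F(A\cup B)+F(A\cap B)$ for all $A,B\subseteq[n]$. With $w(A)=\sum_{k\in A}w_k$, the base polytope is $B(F)=\{w\in\mathbb{R}^n: w(A)\le F(A)\ \forall A\subseteq[n],\ w([n])=F([n])\}$, with vertex set $\mathrm{vert}(B(F))$; the Lovász extension is $f(x)=\max_{w\in B(F)}w^\top x$. A function $g$ is $\beta$-strongly convex ($\beta>0$) if $g-\frac{\beta}{2}\|\cdot\|^2$ is convex, and $\alpha$-smooth ($\alpha>0$) if $g-\frac{\alpha}{2}\|\cdot\|^2$ is concave. Convex functions are assumed closed and proper. $g^*(w)=\max_{x\in\mathbb{R}^n}w^\top x-g(x)$ is the Fenchel conjugate. Algorithm L-KM (Limited Memory Kelley's Method) for minimizing $g+f$ with tolerance $\epsilon\ge 0$: choose $x^{(0)}\in\mathbb{R}^n$ and a nonempty affinely independent set $\mathcal{V}^{(0)}\subseteq\mathrm{vert}(B(F))$. For $i=1,2,\dots$: (1) define $f_{(i)}(x)=\max\{w^\top x: w\in\mathcal{V}^{(i-1)}\}$ and solve $x^{(i)}=\operatorname{argmin}\, g(x)+f_{(i)}(x)$; (2) compute $f(x^{(i)})=\max_{w\in B(F)}w^\top x^{(i)}$ and $v^{(i)}\in\partial f(x^{(i)})=\operatorname{argmax}_{w\in B(F)}w^\top x^{(i)}$; (3) break if $p^{(i)}-d^{(i)}\le\epsilon$, where $p^{(i)}=g(x^{(i)})+f(x^{(i)})$ and $d^{(i)}=g(x^{(i)})+f_{(i)}(x^{(i)})$;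 (4) let $\mathcal{A}^{(i)}=\{w\in\mathcal{V}^{(i-1)}: w^\top x^{(i)}=f_{(i)}(x^{(i)})\}$ and $\mathcal{V}^{(i)}=\mathcal{A}^{(i)}\cup\{v^{(i)}\}$. Return $x^{(i)}$. Algorithm L-FCFW (Limited Memory Fully Corrective Frank-Wolfe) for maximizing a smooth concave $h$ over $B(F)$ with tolerance $\epsilon\ge0$: choose a nonempty set $\mathcal{V}^{(0)}\subseteq\mathrm{vert}(B(F))$. For $i=1,2,\dots$: (1) solve $w^{(i)}=\operatorname{argmax}\{h(w): w\in\mathrm{conv}(\mathcal{V}^{(i-1)})\}$ and define $\lambda_v\ge0$ ($v\in\mathcal{V}^{(i-1)}$) so that $w^{(i)}=\sum_v\lambda_v v$ and $\sum_v\lambda_v=1$; (2) compute $x^{(i)}=\nabla h(w^{(i)})$ and solve $v^{(i)}=\operatorname{argmax}\{w^\top x^{(i)}: w\in B(F)\}$; (3) break if $p^{(i)}-d^{(i)}\le\epsilon$, where $p^{(i)}=(v^{(i)})^\top x^{(i)}$ and $d^{(i)}=(w^{(i)})^\top x^{(i)}$; (4) choose a superset of active vertices $\mathcal{B}^{(i)}\supseteq\{w\in\mathcal{V}^{(i-1)}:\lambda_w>0\}$ and set $\mathcal{V}^{(i)}=\mathcal{B}^{(i)}\cup\{v^{(i)}\}$. Return $w^{(i)}$.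
   Formalization: Item 3 is false verbatim when g(x^(i)) ≠ 0; proved instead: the L-KM bounds p^(i), d^(i) equal g(x^(i)) plus the L-FCFW bounds. Also assumed: both algorithms use the same ε and pick the same maximizer v^(i) whenever their x^(i) agree. *)

theory Defs
  imports "HOL-Analysis.Analysis"
begin

text \<open>
  The ground set \<open>[n]\<close> is the (finite) index type \<open>'n\<close>, so that \<open>\<real>\<^sup>n\<close> is \<open>real ^ 'n\<close>.
\<close>

definition submodular :: "('n::finite set \<Rightarrow> real) \<Rightarrow> bool" where
  "submodular F \<longleftrightarrow> (\<forall>A B. F A + F B \<ge> F (A \<union> B) + F (A \<inter> B))"

definition base_polytope :: "('n::finite set \<Rightarrow> real) \<Rightarrow> (real ^ 'n) set" where
  "base_polytope F =
     {w. (\<forall>A. (\<Sum>k\<in>A. w $ k) \<le> F A) \<and> (\<Sum>k\<in>UNIV. w $ k) = F UNIV}"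

definition base_vertices :: "('n::finite set \<Rightarrow> real) \<Rightarrow> (real ^ 'n) set" where
  "base_vertices F = {v. v extreme_point_of base_polytope F}"

text \<open>
  The supremum is a maximum if \<open>F\<close> is submodular and \<open>F {} = 0\<close>, since the base polytope is
  then nonempty and compact.
\<close>

definition lovasz_extension :: "('n::finite set \<Rightarrow> real) \<Rightarrow> real ^ 'n \<Rightarrow> real" where
  "lovasz_extension F x = (SUP w\<in>base_polytope F. w \<bullet> x)"

definition strongly_convex :: "real \<Rightarrow> ('a::euclidean_space \<Rightarrow> real) \<Rightarrow> bool" where
  "strongly_convex \<beta> g \<longleftrightarrow> \<beta> > 0 \<and> convex_on UNIV (\<lambda>x. g x - \<beta> / 2 * (norm x)\<^sup>2)"

definition smooth :: "real \<Rightarrow> ('a::euclidean_space \<Rightarrow> real) \<Rightarrow> bool" where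
  "smooth \<alpha> g \<longleftrightarrow> \<alpha> > 0 \<and> concave_on UNIV (\<lambda>x. g x - \<alpha> / 2 * (norm x)\<^sup>2)"

text \<open>
  The real-valued supremum is meaningful for strongly convex \<open>g\<close>, where it is a maximum;
  a real-valued convex \<open>g\<close> is automatically closed and proper.
\<close>

definition fenchel_conjugate :: "('a::euclidean_space \<Rightarrow> real) \<Rightarrow> 'a \<Rightarrow> real" where
  "fenchel_conjugate g w = (SUP x. w \<bullet> x - g x)"

definition piecewise_model :: "'a::euclidean_space set \<Rightarrow> 'a \<Rightarrow> real" where
  "piecewise_model V x = Max ((\<lambda>w. w \<bullet> x) ` V)"

text \<open>
  An execution is recorded as a trace. \<open>iters\<close> is the number of the iteration in which the
  algorithm breaks (\<open>\<infinity>\<close> if it never does). Entries of iteration \<open>i\<close> are meaningful for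
  \<open>1 \<le> i \<le> iters\<close>, except that step (4), which produces the active set and the set of vertices,
  is only reached for \<open>i < iters\<close>. The initial data \<open>x\<^sup>(\<^sup>0\<^sup>)\<close> and \<open>\<V>\<^sup>(\<^sup>0\<^sup>)\<close> are the entries at \<open>0\<close>;
  \<open>x\<^sup>(\<^sup>0\<^sup>)\<close> is arbitrary and never used.
\<close>

record 'a lkm_trace =
  km_iters :: enat
  km_x :: "nat \<Rightarrow> 'a"
  km_v :: "nat \<Rightarrow> 'a"
  km_A :: "nat \<Rightarrow> 'a set"
  km_V :: "nat \<Rightarrow> 'a set"
  km_p :: "nat \<Rightarrow> real"
  km_d :: "nat \<Rightarrow> real"

definition lkm_step ::
  "(real ^ 'n \<Rightarrow> real) \<Rightarrow> ('n::finite set \<Rightarrow> real) \<Rightarrow> real \<Rightarrow> (real ^ 'n) lkm_trace \<Rightarrow> nat \<Rightarrow> bool" where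
  "lkm_step g F \<epsilon> K i \<longleftrightarrow>
     is_arg_min (\<lambda>y. g y + piecewise_model (km_V K (i - 1)) y) (\<lambda>_. True) (km_x K i) \<and>
     is_arg_max (\<lambda>w. w \<bullet> km_x K i) (\<lambda>w. w \<in> base_polytope F) (km_v K i) \<and>
     km_p K i = g (km_x K i) + lovasz_extension F (km_x K i) \<and>
     km_d K i = g (km_x K i) + piecewise_model (km_V K (i - 1)) (km_x K i) \<and>
     (km_p K i - km_d K i \<le> \<epsilon> \<longleftrightarrow> enat i = km_iters K) \<and>
     (enat i < km_iters K \<longrightarrow>
        km_A K i = {w \<in> km_V K (i - 1).
                      w \<bullet> km_x K i = piecewise_model (km_V K (i - 1)) (km_x K i)} \<and>
        km_V K i = km_A K i \<union> {km_v K i})"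

definition lkm_run ::
  "(real ^ 'n \<Rightarrow> real) \<Rightarrow> ('n::finite set \<Rightarrow> real) \<Rightarrow> real \<Rightarrow> (real ^ 'n) lkm_trace \<Rightarrow> bool" where
  "lkm_run g F \<epsilon> K \<longleftrightarrow>
     km_V K 0 \<noteq> {} \<and> \<not> affine_dependent (km_V K 0) \<and> km_V K 0 \<subseteq> base_vertices F \<and>
     1 \<le> km_iters K \<and>
     (\<forall>i. 1 \<le> i \<and> enat i \<le> km_iters K \<longrightarrow> lkm_step g F \<epsilon> K i)"

text \<open>
  Pitfall: \<open>fw_p\<close> and \<open>fw_d\<close> are the linear quantities \<open>v\<^sup>T x\<close> and \<open>w\<^sup>T x\<close>. For
  \<open>h w = - g\<^sup>* (- w)\<close> one has \<open>h w = g x + w\<^sup>T x\<close>, so the upper and lower bounds on the maximum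
  of \<open>h\<close>, namely \<open>h w + (v - w)\<^sup>T \<nabla>h w\<close> and \<open>h w\<close>, are \<open>g x + fw_p\<close> and \<open>g x + fw_d\<close>;
  these are comparable to \<open>km_p\<close> and \<open>km_d\<close>, which do contain \<open>g x\<close>.
\<close>

record 'a lfcfw_trace =
  fw_iters :: enat
  fw_w :: "nat \<Rightarrow> 'a"
  fw_lam :: "nat \<Rightarrow> 'a \<Rightarrow> real"
  fw_x :: "nat \<Rightarrow> 'a"
  fw_v :: "nat \<Rightarrow> 'a"
  fw_B :: "nat \<Rightarrow> 'a set"
  fw_V :: "nat \<Rightarrow> 'a set"
  fw_p :: "nat \<Rightarrow> real"
  fw_d :: "nat \<Rightarrow> real"

definition lfcfw_step ::
  "(real ^ 'n \<Rightarrow> real) \<Rightarrow> ('n::finite set \<Rightarrow> real) \<Rightarrow> real \<Rightarrow> (real ^ 'n) lfcfw_trace \<Rightarrow> nat \<Rightarrow> bool" where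
  "lfcfw_step h F \<epsilon> W i \<longleftrightarrow>
     is_arg_max h (\<lambda>w. w \<in> convex hull (fw_V W (i - 1))) (fw_w W i) \<and>
     (\<forall>v\<in>fw_V W (i - 1). 0 \<le> fw_lam W i v) \<and>
     fw_w W i = (\<Sum>v\<in>fw_V W (i - 1). fw_lam W i v *\<^sub>R v) \<and>
     (\<Sum>v\<in>fw_V W (i - 1). fw_lam W i v) = 1 \<and>
     GDERIV h (fw_w W i) :> fw_x W i \<and>
     is_arg_max (\<lambda>w. w \<bullet> fw_x W i) (\<lambda>w. w \<in> base_polytope F) (fw_v W i) \<and>
     fw_p W i = fw_v W i \<bullet> fw_x W i \<and>
     fw_d W i = fw_w W i \<bullet> fw_x W i \<and>
     (fw_p W i - fw_d W i \<le> \<epsilon> \<longleftrightarrow> enat i = fw_iters W) \<and>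
     (enat i < fw_iters W \<longrightarrow>
        {v \<in> fw_V W (i - 1). fw_lam W i v > 0} \<subseteq> fw_B W i \<and>
        fw_V W i = fw_B W i \<union> {fw_v W i})"

definition lfcfw_run ::
  "(real ^ 'n \<Rightarrow> real) \<Rightarrow> ('n::finite set \<Rightarrow> real) \<Rightarrow> real \<Rightarrow> (real ^ 'n) lfcfw_trace \<Rightarrow> bool" where
  "lfcfw_run h F \<epsilon> W \<longleftrightarrow>
     fw_V W 0 \<noteq> {} \<and> fw_V W 0 \<subseteq> base_vertices F \<and>
     1 \<le> fw_iters W \<and>
     (\<forall>i. 1 \<le> i \<and> enat i \<le> fw_iters W \<longrightarrow> lfcfw_step h F \<epsilon> W i)"

end

theory Submission
  imports Defs
begin

text \<open>
  Let \<open>w\<close> maximise \<open>h = - g\<^sup>*(- \<cdot>)\<close> over \<open>conv \<V>\<close>, and let \<open>x = \<nabla>h w\<close>. By strong convexity,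
  \<open>h w = min\<^sub>y (g y + w\<^sup>T y)\<close> has a unique minimiser; the affine majorant of \<open>h\<close> that it defines is
  tight at \<open>w\<close>, so its slope is the gradient: the minimiser is \<open>x\<close>. First-order optimality of \<open>w\<close>
  says that \<open>max\<^sub>v\<^sub>\<in>\<^sub>\<V> v\<^sup>T x\<close> equals \<open>w\<^sup>T x\<close>. Hence, with \<open>f\<^sub>\<V>\<close> the piecewise linear model,
  \<open>g + f\<^sub>\<V> \<ge> g + w\<^sup>T(\<cdot>) \<ge> h w = g x + f\<^sub>\<V> x\<close>, and every minimiser of \<open>g + f\<^sub>\<V>\<close> also minimises
  \<open>g + w\<^sup>T(\<cdot>)\<close>, so it is \<open>x\<close>. One iteration of each algorithm from the same vertex set thus gives
  the same \<open>x\<close>, the same active set and the same gap.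
\<close>

section \<open>Strongly convex functions: existence and uniqueness of minimisers\<close>

lemma strongly_convex_add_inner:
  fixes g :: "'a::euclidean_space \<Rightarrow> real"
  assumes "strongly_convex \<beta> g"
  shows "strongly_convex \<beta> (\<lambda>x. w \<bullet> x + g x)"
proof -
  have "convex_on UNIV (\<lambda>x. w \<bullet> x)"
    by (rule convex_onI) (auto simp: inner_add_right)
  then have "convex_on UNIV (\<lambda>x. w \<bullet> x + (g x - \<beta> / 2 * (norm x)\<^sup>2))"
    using assms by (intro convex_on_add) (auto simp: strongly_convex_def)
  then show ?thesis
    using assms by (simp add: strongly_convex_def add_diff_eq)
qed

text \<open>Continuity bounds \<open>f\<close> by some \<open>M\<close> on the unit ball. For
  \<open>y\<close> outside it, the unit vector along \<open>y\<close> lies on the segment from 0 to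
  \<open>y\<close>, so by convexity \<open>f\<close> can drop at most linearly in
  \<open>norm y\<close>.\<close>

lemma convex_on_linear_lower_bound:
  fixes f :: "'a::euclidean_space \<Rightarrow> real"
  assumes "convex_on UNIV f"
  obtains C where "\<And>y. f y \<ge> - C * (1 + norm y)"
proof -
  have cont: "continuous_on (cball 0 1) f"
    using convex_on_continuous[OF open_UNIV assms] continuous_on_subset by blast
  then have "bounded (f ` cball 0 1)"
    by (intro compact_imp_bounded compact_continuous_image) auto
  then obtain M where "\<forall>y\<in>cball 0 1. \<bar>f y\<bar> \<le> M"
    by (auto simp: bounded_iff)
  then have M: "\<bar>f y\<bar> \<le> M" if "norm y \<le> 1" for y
    using that by simp
  have M0: "\<bar>f 0\<bar> \<le> M" using M[of 0] by simp
  have "f y \<ge> - (2 * M) * (1 + norm y)" for y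
  proof (cases "norm y \<le> 1")
    case True
    have "M * norm y \<ge> 0" using M0 by (intro mult_nonneg_nonneg) auto
    moreover have "- (2 * M) * (1 + norm y) = - 2 * M - 2 * (M * norm y)"
      by (simp add: algebra_simps)
    ultimately show ?thesis using M[OF True] M0 by linarith
  next
    case False
    then have pos: "norm y > 0" "1 / norm y \<le> 1"
      by (auto simp del: zero_less_norm_iff simp: divide_le_eq_1)
    have "f ((1 - 1 / norm y) *\<^sub>R 0 + (1 / norm y) *\<^sub>R y)
        \<le> (1 - 1 / norm y) * f 0 + (1 / norm y) * f y"
      using pos by (intro convex_onD[OF assms]) auto
    moreover have "\<bar>f ((1 / norm y) *\<^sub>R y)\<bar> \<le> M"
      using pos by (intro M) simp
    ultimately have "- M \<le> (1 - 1 / norm y) * f 0 + (1 / norm y) * f y"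
      by simp
    then have "- M * norm y \<le> ((1 - 1 / norm y) * f 0 + (1 / norm y) * f y) * norm y"
      using pos by (intro mult_right_mono) auto
    also have "\<dots> = (norm y - 1) * f 0 + f y"
      using pos by (simp add: field_simps)
    also have "(norm y - 1) * f 0 \<le> (norm y - 1) * M"
      using False M0 by (intro mult_left_mono) auto
    finally show ?thesis using M0 by (simp add: algebra_simps)
  qed
  then show ?thesis using that by blast
qed

text \<open>Coercivity: the quadratic term beats the linear lower bound on the convex remainder, so
  values outside a large ball are at least \<open>g 0\<close>, and compactness gives a minimiser
  inside it.\<close>

lemma strongly_convex_attains_min:
  fixes g :: "'a::euclidean_space \<Rightarrow> real"
  assumes "strongly_convex \<beta> g"
  obtains z where "\<And>y. g z \<le> g y"
proof -
  define f where "f \<equiv> \<lambda>x. g x - \<beta> / 2 * (norm x)\<^sup>2"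
  have \<beta>: "\<beta> > 0" and f: "convex_on UNIV f"
    using assms by (auto simp: strongly_convex_def f_def)
  have g_eq: "g = (\<lambda>x. f x + \<beta> / 2 * (norm x)\<^sup>2)" by (auto simp: f_def)
  obtain C where C: "\<And>y. f y \<ge> - C * (1 + norm y)"
    using convex_on_linear_lower_bound[OF f] by blast
  have "continuous_on UNIV g"
    unfolding g_eq using convex_on_continuous[OF open_UNIV f] by (intro continuous_intros)
  then have cont: "continuous_on (cball 0 R) g" for R
    using continuous_on_subset by blast
  \<comment> \<open>For \<open>r\<close> beyond it, \<open>1 + r\<close> is at most
    \<open>2 * r\<close>, and \<open>\<beta> / 2 * r\<close> is at least the remaining coefficient
    \<open>2 * \<bar>C\<bar> + \<bar>g 0\<bar>\<close>.\<close>
  define R where "R = max 1 (2 * (2 * \<bar>C\<bar> + \<bar>g 0\<bar>) / \<beta>)"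
  have R: "- C * (1 + r) + \<beta> / 2 * r\<^sup>2 \<ge> g 0" if "r \<ge> R" for r
  proof -
    have r: "1 \<le> r" "2 * \<bar>C\<bar> + \<bar>g 0\<bar> \<le> \<beta> / 2 * r"
      using that \<beta> by (auto simp: R_def field_simps)
    have "C * (1 + r) \<le> \<bar>C\<bar> * (2 * r)"
      using r by (intro mult_mono) auto
    moreover have "\<bar>g 0\<bar> \<le> \<bar>g 0\<bar> * r"
      using r by (simp add: mult_le_cancel_left1)
    moreover have "(2 * \<bar>C\<bar> + \<bar>g 0\<bar>) * r \<le> \<beta> / 2 * r * r"
      using r by (intro mult_right_mono) auto
    ultimately show ?thesis by (simp add: power2_eq_square algebra_simps)
  qed
  \<comment> \<open>\<open>R\<close> is at least 1, so \<open>\<bar>R\<bar>\<close> is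
    \<open>R\<close>; the absolute value makes nonemptiness immediate for the simplifier.\<close>
  have "cball (0::'a) \<bar>R\<bar> \<noteq> {}" by simp
  then obtain z where z: "z \<in> cball 0 \<bar>R\<bar>" "\<And>y. y \<in> cball 0 \<bar>R\<bar> \<Longrightarrow> g z \<le> g y"
    using continuous_attains_inf[OF compact_cball _ cont] by blast
  have "g z \<le> g y" for y
  proof (cases "norm y \<le> \<bar>R\<bar>")
    case True
    then show ?thesis using z by simp
  next
    case False
    have "g z \<le> g 0" using z by simp
    also have "\<dots> \<le> - C * (1 + norm y) + \<beta> / 2 * (norm y)\<^sup>2"
      using False by (intro R) auto
    also have "\<dots> \<le> g y" using C[of y] by (simp add: g_eq)
    finally show ?thesis .
  qed
  then show ?thesis using that by blast
qed

text \<open>Strong convexity puts the value at the midpoint at least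
  \<open>\<beta> / 8 * (norm (x - y))\<^sup>2\<close> below the common minimum, so this term must be
  zero.\<close>

lemma strongly_convex_min_unique:
  fixes g :: "'a::euclidean_space \<Rightarrow> real"
  assumes g: "strongly_convex \<beta> g"
    and x: "\<And>z. g x \<le> g z" and y: "\<And>z. g y \<le> g z"
  shows "x = y"
proof -
  define m where "m = (1 - 1/2) *\<^sub>R x + (1/2) *\<^sub>R y"
  have \<beta>: "\<beta> > 0" and conv: "convex_on UNIV (\<lambda>x. g x - \<beta> / 2 * (norm x)\<^sup>2)"
    using g by (auto simp: strongly_convex_def)
  have "g m - \<beta> / 2 * (norm m)\<^sup>2
      \<le> (1 - 1/2) * (g x - \<beta> / 2 * (norm x)\<^sup>2) + 1/2 * (g y - \<beta> / 2 * (norm y)\<^sup>2)"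
    unfolding m_def by (rule convex_onD[OF conv]) auto
  moreover have "g x = g y" using x[of y] y[of x] by simp
  moreover have "g x \<le> g m" by (rule x)
  ultimately have "\<beta> * ((norm x)\<^sup>2 + (norm y)\<^sup>2 - 2 * (norm m)\<^sup>2) \<le> 0"
    by (simp add: algebra_simps)
  \<comment> \<open>The parallelogram identity.\<close>
  moreover have "(norm x)\<^sup>2 + (norm y)\<^sup>2 - 2 * (norm m)\<^sup>2 = (norm (x - y))\<^sup>2 / 2"
    by (simp add: m_def power2_norm_eq_inner inner_simps inner_commute field_simps)
  ultimately have "\<beta> * (norm (x - y))\<^sup>2 \<le> 0" by simp
  then show ?thesis using \<beta> by (simp add: mult_le_0_iff)
qed

section \<open>The conjugate dual: Fenchel inequality, gradient, first-order optimality\<close>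

lemma neg_fenchel_conjugate_le:
  fixes g :: "'a::euclidean_space \<Rightarrow> real"
  assumes "strongly_convex \<beta> g"
  shows "- fenchel_conjugate g (- w) \<le> w \<bullet> y + g y"
proof -
  obtain z where "\<And>y. w \<bullet> z + g z \<le> w \<bullet> y + g y"
    using strongly_convex_attains_min[OF strongly_convex_add_inner[OF assms]] by blast
  \<comment> \<open>A real-valued \<open>SUP\<close> is guaranteed to dominate its terms only over a
    set bounded above; the attained minimum supplies the bound.\<close>
  then have "bdd_above (range (\<lambda>x. - w \<bullet> x - g x))"
    by (intro bdd_aboveI[of _ "- (w \<bullet> z + g z)"]) (auto simp: algebra_simps)
  then have "- w \<bullet> y - g y \<le> fenchel_conjugate g (- w)"
    unfolding fenchel_conjugate_def by (intro cSUP_upper) auto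
  then show ?thesis by simp
qed

lemma neg_fenchel_conjugate_eq:
  assumes "\<And>y. w \<bullet> z + g z \<le> w \<bullet> y + g y"
  shows "- fenchel_conjugate g (- w) = w \<bullet> z + g z"
proof -
  have "fenchel_conjugate g (- w) = - w \<bullet> z - g z"
    unfolding fenchel_conjugate_def
    using assms by (intro cSup_eq_maximum) (auto simp: algebra_simps)
  then show ?thesis by simp
qed

lemma gradient_neg_fenchel_conjugate_minimises:
  fixes g :: "'a::euclidean_space \<Rightarrow> real"
  assumes g: "strongly_convex \<beta> g"
    and grad: "GDERIV (\<lambda>w. - fenchel_conjugate g (- w)) w :> x"
  shows "w \<bullet> x + g x \<le> w \<bullet> y + g y"
proof -
  define h where "h \<equiv> \<lambda>w. - fenchel_conjugate g (- w)"
  obtain z where z: "\<And>y. w \<bullet> z + g z \<le> w \<bullet> y + g y"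
    using strongly_convex_attains_min[OF strongly_convex_add_inner[OF g]] by blast
  have hw: "h w = w \<bullet> z + g z"
    unfolding h_def by (rule neg_fenchel_conjugate_eq[OF z])
  have le: "h u \<le> u \<bullet> z + g z" for u
    unfolding h_def by (rule neg_fenchel_conjugate_le[OF g])
  \<comment> \<open>This function is smallest at \<open>w\<close>, where the affine majorant
    \<open>u \<bullet> z + g z\<close> touches \<open>h\<close>.\<close>
  have "((\<lambda>u. u \<bullet> z - h u) has_derivative (\<lambda>u. u \<bullet> z - u \<bullet> x)) (at w)"
    using grad unfolding gderiv_def h_def[symmetric] by (intro derivative_intros)
  moreover have "\<forall>\<^sub>F u in at w. w \<bullet> z - h w \<le> u \<bullet> z - h u"
    using hw le by (intro always_eventually) (auto simp: algebra_simps)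
  ultimately have "(\<lambda>u. u \<bullet> z - u \<bullet> x) = (\<lambda>_. 0)"
    by (rule has_derivative_local_min)
  \<comment> \<open>The vanishing derivative, evaluated in the direction
    \<open>z - x\<close>.\<close>
  then have "(z - x) \<bullet> (z - x) = 0"
    by (metis inner_diff_right)
  then show ?thesis using z by simp
qed

text \<open>A positive derivative in direction \<open>u - w\<close> would make \<open>h\<close>
  exceed \<open>h w\<close> a short way along the segment to \<open>u\<close>, which stays in
  \<open>C\<close>.\<close>

lemma gradient_at_max_on_convex:
  fixes h :: "'a::real_inner \<Rightarrow> real"
  assumes "convex C" and "w \<in> C" and max: "\<And>u. u \<in> C \<Longrightarrow> h u \<le> h w"
    and grad: "GDERIV h w :> x" and "u \<in> C"
  shows "u \<bullet> x \<le> w \<bullet> x"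
proof (rule ccontr)
  assume "\<not> u \<bullet> x \<le> w \<bullet> x"
  then have pos: "(u - w) \<bullet> x > 0" by (simp add: inner_diff_left)
  define \<phi> where "\<phi> \<equiv> \<lambda>t::real. h (w + t *\<^sub>R (u - w))"
  \<comment> \<open>The summand \<open>0 *\<^sub>R (u - w)\<close> presents \<open>w\<close> as the
    path at \<open>t = 0\<close>, the form the chain rule expects.\<close>
  have "(h has_derivative (\<lambda>d. d \<bullet> x)) (at (w + 0 *\<^sub>R (u - w)))"
    using grad by (simp add: gderiv_def)
  then have "((\<lambda>t::real. h (w + t *\<^sub>R (u - w))) has_derivative (\<lambda>t. (t *\<^sub>R (u - w)) \<bullet> x)) (at 0)"
    by (rule has_derivative_compose[rotated]) (auto intro!: derivative_eq_intros)
  then have "(\<phi> has_real_derivative (u - w) \<bullet> x) (at 0)"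
    by (simp add: \<phi>_def has_field_derivative_def mult.commute[of _ "(u - w) \<bullet> x"])
  then obtain d where d: "d > 0" "\<And>t. 0 < t \<Longrightarrow> t < d \<Longrightarrow> \<phi> 0 < \<phi> (0 + t)"
    using DERIV_pos_inc_right[OF _ pos] by blast
  \<comment> \<open>Half of \<open>d\<close> keeps \<open>t\<close> in the range of increase; the
    cap 1 keeps the point on the segment.\<close>
  define t where "t = min (d / 2) 1"
  have t: "0 < t" "t < d" "t \<le> 1" using d by (auto simp: t_def)
  have "w + t *\<^sub>R (u - w) = (1 - t) *\<^sub>R w + t *\<^sub>R u" by (simp add: algebra_simps)
  also have "\<dots> \<in> C" using assms t by (intro convexD) auto
  finally show False using d(2)[of t] t max by (force simp: \<phi>_def)
qed

section \<open>Comparison of the algorithms: one subproblem, one iteration, whole runs\<close>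

lemma inner_le_piecewise_model:
  assumes "finite V" and "w \<in> convex hull V"
  shows "w \<bullet> x \<le> piecewise_model V x"
proof -
  have "V \<subseteq> {u. u \<bullet> x \<le> piecewise_model V x}"
    using assms(1) by (auto simp: piecewise_model_def)
  moreover have "convex {u. u \<bullet> x \<le> piecewise_model V x}"
    using convex_halfspace_le[of x] by (simp add: inner_commute)
  ultimately have "convex hull V \<subseteq> {u. u \<bullet> x \<le> piecewise_model V x}"
    by (rule hull_minimal)
  then show ?thesis using assms(2) by auto
qed

lemma lovasz_extension_eq:
  assumes "is_arg_max (\<lambda>w. w \<bullet> x) (\<lambda>w. w \<in> base_polytope F) v"
  shows "lovasz_extension F x = v \<bullet> x"
  unfolding lovasz_extension_def
  using assms by (intro cSup_eq_maximum) (auto simp: is_arg_max_linorder)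

lemma dual_solution_matches_primal:
  fixes g :: "'a::euclidean_space \<Rightarrow> real"
  assumes g: "strongly_convex \<beta> g" and V: "finite V" "V \<noteq> {}"
    and y: "is_arg_min (\<lambda>y. g y + piecewise_model V y) (\<lambda>_. True) y"
    and w: "is_arg_max (\<lambda>w. - fenchel_conjugate g (- w)) (\<lambda>w. w \<in> convex hull V) w"
    and grad: "GDERIV (\<lambda>w. - fenchel_conjugate g (- w)) w :> x"
  shows "y = x" and "piecewise_model V x = w \<bullet> x"
proof -
  have wV: "w \<in> convex hull V" using w by (simp add: is_arg_max_linorder)
  have le: "u \<bullet> x \<le> w \<bullet> x" if "u \<in> convex hull V" for u
    by (rule gradient_at_max_on_convex[OF convex_convex_hull wV _ grad that])
      (use w in \<open>auto simp: is_arg_max_linorder\<close>)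
  have "piecewise_model V x \<le> w \<bullet> x"
    using V le by (auto simp: piecewise_model_def intro: hull_inc)
  with inner_le_piecewise_model[OF V(1) wV] show eq: "piecewise_model V x = w \<bullet> x"
    by (simp add: order_antisym)
  have min: "w \<bullet> x + g x \<le> w \<bullet> z + g z" for z
    by (rule gradient_neg_fenchel_conjugate_minimises[OF g grad])
  have "w \<bullet> y + g y \<le> w \<bullet> z + g z" for z
  proof -
    have "w \<bullet> y + g y \<le> g y + piecewise_model V y"
      using inner_le_piecewise_model[OF V(1) wV, of y] by simp
    also have "\<dots> \<le> g x + piecewise_model V x"
      using y by (simp add: is_arg_min_linorder)
    finally show ?thesis using min[of z] eq by simp
  qed
  then show "y = x"
    using strongly_convex_min_unique[OF strongly_convex_add_inner[OF g]] min by blast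
qed

text \<open>Once \<open>x\<close> and the model value agree, the bounds of the two algorithms differ
  by the same summand \<open>g x\<close>. Their gaps are then equal, so the stopping tests
  agree.\<close>

lemma lkm_lfcfw_step_match:
  assumes g: "strongly_convex \<beta> g"
    and V: "finite (km_V K j)" "km_V K j \<noteq> {}" "km_V K j = fw_V W j"
    and K: "lkm_step g F \<epsilon> K (Suc j)"
    and W: "lfcfw_step (\<lambda>w. - fenchel_conjugate g (- w)) F \<epsilon> W (Suc j)"
  shows "km_x K (Suc j) = fw_x W (Suc j)"
    and "piecewise_model (km_V K j) (km_x K (Suc j)) = fw_w W (Suc j) \<bullet> fw_x W (Suc j)"
    and "km_p K (Suc j) = g (km_x K (Suc j)) + fw_p W (Suc j)"
    and "km_d K (Suc j) = g (km_x K (Suc j)) + fw_d W (Suc j)"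
    and "enat (Suc j) = km_iters K \<longleftrightarrow> enat (Suc j) = fw_iters W"
proof -
  note defs = lkm_step_def lfcfw_step_def
  have y: "is_arg_min (\<lambda>y. g y + piecewise_model (km_V K j) y) (\<lambda>_. True) (km_x K (Suc j))"
    using K by (simp add: defs)
  have w: "is_arg_max (\<lambda>w. - fenchel_conjugate g (- w)) (\<lambda>w. w \<in> convex hull (km_V K j))
      (fw_w W (Suc j))"
    using W unfolding defs V(3) diff_Suc_1 by blast
  have grad: "GDERIV (\<lambda>w. - fenchel_conjugate g (- w)) (fw_w W (Suc j)) :> fw_x W (Suc j)"
    using W unfolding defs by blast
  have x: "km_x K (Suc j) = fw_x W (Suc j)"
    and m: "piecewise_model (km_V K j) (fw_x W (Suc j)) = fw_w W (Suc j) \<bullet> fw_x W (Suc j)"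
    using dual_solution_matches_primal[OF g V(1,2) y w grad] by simp_all
  \<comment> \<open>The extension is a maximum, so the maximiser of L-FCFW evaluates it whichever
    one L-KM picked.\<close>
  have "lovasz_extension F (fw_x W (Suc j)) = fw_v W (Suc j) \<bullet> fw_x W (Suc j)"
    using W by (intro lovasz_extension_eq) (simp add: defs)
  then have p: "km_p K (Suc j) = g (km_x K (Suc j)) + fw_p W (Suc j)"
    and d: "km_d K (Suc j) = g (km_x K (Suc j)) + fw_d W (Suc j)"
    using K W x m by (simp_all add: defs)
  then have "km_p K (Suc j) - km_d K (Suc j) = fw_p W (Suc j) - fw_d W (Suc j)" by simp
  then show "enat (Suc j) = km_iters K \<longleftrightarrow> enat (Suc j) = fw_iters W"
    using K W by (auto simp: defs)
  show "km_x K (Suc j) = fw_x W (Suc j)" "km_p K (Suc j) = g (km_x K (Suc j)) + fw_p W (Suc j)"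
    "km_d K (Suc j) = g (km_x K (Suc j)) + fw_d W (Suc j)" by fact+
  show "piecewise_model (km_V K j) (km_x K (Suc j)) = fw_w W (Suc j) \<bullet> fw_x W (Suc j)"
    using m x by simp
qed

theorem theorem6p1:
  fixes F :: "'n::finite set \<Rightarrow> real"
    and g :: "real ^ 'n \<Rightarrow> real"
    and \<alpha> \<beta> \<epsilon> :: real
    and K :: "(real ^ 'n) lkm_trace"
    and W :: "(real ^ 'n) lfcfw_trace"
  assumes "submodular F" and "F {} = 0"
    and "smooth \<alpha> g" and "strongly_convex \<beta> g"
    and "0 \<le> \<epsilon>"
    and "lkm_run g F \<epsilon> K"
    and "lfcfw_run (\<lambda>w. - fenchel_conjugate g (- w)) F \<epsilon> W"
    and same_start: "km_V K 0 = fw_V W 0"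
    and choice_B: "\<And>i. 1 \<le> i \<Longrightarrow> enat i < fw_iters W \<Longrightarrow>
           fw_B W i = {v \<in> fw_V W (i - 1). v \<bullet> fw_x W i = fw_w W i \<bullet> fw_x W i}"
    and same_ties: "\<And>i. 1 \<le> i \<Longrightarrow> enat i \<le> km_iters K \<Longrightarrow> enat i \<le> fw_iters W \<Longrightarrow>
           km_x K i = fw_x W i \<Longrightarrow> km_v K i = fw_v W i"
  shows "km_iters K = fw_iters W \<and>
         (\<forall>i. 1 \<le> i \<and> enat i \<le> km_iters K \<longrightarrow> km_x K i = fw_x W i) \<and>
         (\<forall>i. enat i < km_iters K \<longrightarrow> km_V K i = fw_V W i) \<and>
         (\<forall>i. 1 \<le> i \<and> enat i \<le> km_iters K \<longrightarrow>
            km_p K i = g (km_x K i) + fw_p W i \<and>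
            km_d K i = g (km_x K i) + fw_d W i)"
proof -
  note g = \<open>strongly_convex \<beta> g\<close>
  have iters_pos: "enat 0 < km_iters K" "enat 0 < fw_iters W"
    using assms(6,7) by (auto simp: lkm_run_def lfcfw_run_def one_enat_def Suc_ile_eq)
  have K: "lkm_step g F \<epsilon> K (Suc i)" if "enat i < km_iters K" for i
    using assms(6) that by (simp add: lkm_run_def Suc_ile_eq)
  have W: "lfcfw_step (\<lambda>w. - fenchel_conjugate g (- w)) F \<epsilon> W (Suc i)"
    if "enat i < fw_iters W" for i
    using assms(7) that by (simp add: lfcfw_run_def Suc_ile_eq)
  \<comment> \<open>\<open>enat i\<close> lies below the count exactly when iteration
    \<open>Suc i\<close> is executed. Finiteness and nonemptiness keep the \<open>Max\<close> in the
    model meaningful.\<close>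
  have inv: "(enat i < km_iters K \<longleftrightarrow> enat i < fw_iters W) \<and>
      (enat i < km_iters K \<longrightarrow> finite (km_V K i) \<and> km_V K i \<noteq> {} \<and> km_V K i = fw_V W i)" for i
  proof (induction i)
    case 0
    have "finite (km_V K 0)" "km_V K 0 \<noteq> {}"
      using assms(6) aff_independent_finite by (auto simp: lkm_run_def)
    then show ?case using same_start iters_pos by simp
  next
    case (Suc i)
    show ?case
    proof (cases "enat i < km_iters K")
      case False
      have "enat i < enat (Suc i)" by simp
      then have "\<not> enat (Suc i) < km_iters K" "\<not> enat (Suc i) < fw_iters W"
        using False Suc.IH order.strict_trans by blast+
      then show ?thesis by blast
    next
      case True
      then have V: "finite (km_V K i)" "km_V K i \<noteq> {}" "km_V K i = fw_V W i"
        and True': "enat i < fw_iters W"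
        using Suc.IH by auto
      note step = lkm_lfcfw_step_match[OF g V K[OF True] W[OF True']]
      have le: "enat (Suc i) \<le> km_iters K" "enat (Suc i) \<le> fw_iters W"
        using True True' by (auto simp: Suc_ile_eq)
      then have iff: "enat (Suc i) < km_iters K \<longleftrightarrow> enat (Suc i) < fw_iters W"
        using step(5) by (auto simp: order.strict_iff_order)
      have "finite (km_V K (Suc i)) \<and> km_V K (Suc i) \<noteq> {} \<and> km_V K (Suc i) = fw_V W (Suc i)"
        if lt: "enat (Suc i) < km_iters K"
      proof -
        have lt': "enat (Suc i) < fw_iters W" using iff lt by simp
        \<comment> \<open>A linear functional may have several maximisers on the base polytope;
          consistent tie-breaking makes the two new vertices equal.\<close>
        have "km_v K (Suc i) = fw_v W (Suc i)"
          using same_ties[of "Suc i"] le step(1) by simp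
        \<comment> \<open>The membership tests coincide because the model value at the common
          \<open>x\<close> is the inner product of \<open>x\<close> with the dual iterate.\<close>
        moreover have "km_A K (Suc i) = fw_B W (Suc i)"
          using K[OF True] lt choice_B[OF _ lt'] step(1,2) V(3) by (simp add: lkm_step_def)
        moreover have "km_V K (Suc i) = km_A K (Suc i) \<union> {km_v K (Suc i)}"
          and "km_A K (Suc i) \<subseteq> km_V K i"
          using K[OF True] lt by (auto simp: lkm_step_def)
        moreover have "fw_V W (Suc i) = fw_B W (Suc i) \<union> {fw_v W (Suc i)}"
          using W[OF True'] lt' by (simp add: lfcfw_step_def)
        ultimately show ?thesis using V(1) by (auto intro: finite_subset)
      qed
      then show ?thesis using iff by blast
    qed
  qed
  \<comment> \<open>If the counts differed, the smaller would be finite, and the invariant would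
    fail at that index.\<close>
  have "km_iters K = fw_iters W"
  proof (rule linorder_cases)
    assume "km_iters K < fw_iters W"
    then obtain k where "km_iters K = enat k" by (cases "km_iters K") auto
    then show ?thesis using inv[of k] \<open>km_iters K < fw_iters W\<close> by simp
  next
    assume "fw_iters W < km_iters K"
    then obtain k where "fw_iters W = enat k" by (cases "fw_iters W") auto
    then show ?thesis using inv[of k] \<open>fw_iters W < km_iters K\<close> by simp
  qed
  moreover have "km_x K i = fw_x W i \<and> km_p K i = g (km_x K i) + fw_p W i \<and>
      km_d K i = g (km_x K i) + fw_d W i" if "1 \<le> i" "enat i \<le> km_iters K" for i
  proof -
    obtain j where j: "i = Suc j" using \<open>1 \<le> i\<close> by (cases i) auto
    then have lt: "enat j < km_iters K" "enat j < fw_iters W"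
      using that inv[of j] by (auto simp: Suc_ile_eq)
    have V: "finite (km_V K j)" "km_V K j \<noteq> {}" "km_V K j = fw_V W j"
      using inv[of j] lt by auto
    show ?thesis
      unfolding j
      using lkm_lfcfw_step_match[OF g V K[OF lt(1)] W[OF lt(2)]]
      by simp
  qed
  ultimately show ?thesis using inv by blast
qed

end
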